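(* Let $X=\begin{pmatrix}x&y\\ y&x\end{pmatrix}\in\mathcal{B}^*$. If $X$ is not an atom of $M_2(\mathbb{N}_0)^\bullet$, then $$x\le 1+\frac{y^2}{4}\quad\text{and}\quad y\le 1+\frac{x^2}{4}.$$ Furthermore, these bounds are sharp: there exists a non-atom $\begin{pmatrix}x&y\\ y&x\end{pmatrix}\in\mathcal{B}^*$ with $x=1+\frac{y^2}{4}$, and there exists a non-atom $\begin{pmatrix}x&y\\ y&x\end{pmatrix}\in\mathcal{B}^*$ with $y=1+\frac{x^2}{4}$.
   Context: $M_2(\mathbb{N}_0)^\bullet$ is the semigroup, under matrix multiplication, of $2\times 2$ matrices with non-negative integer entries and non-zero determinant. Its only units are $I=\begin{pmatrix}1&0\\0&1\end{pmatrix}$ and $J=\begin{pmatrix}0&1\\1&0\end{pmatrix}$. An atom is a non-unit $X\in M_2(\mathbb{N}_0)^\bullet$ such that whenever $X=AB$ with $A,B\in M_2(\mathbb{N}_0)^\bullet$, at least one of $A,B$ is a unit. $\mathcal{B}^*=\left\{\begin{pmatrix}x&y\\ y&x\end{pmatrix}\in M_2(\mathbb{N}_0)^\bullet:\gcd(x,y)=1\right\}$, with the convention $\gcd(n,0)=n$. The displayed inequalities and equalities are between rational numbers. *)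

theory Defs
  imports "HOL-Analysis.Analysis" "HOL-Algebra.Group"
begin

text \<open>The determinant needs a commutative ring, so it is taken after embedding the entries
  into the integers.\<close>

definition M2N0 :: "(nat ^ 2 ^ 2) monoid" where
  "M2N0 = \<lparr>carrier = {A. det (map_matrix int A) \<noteq> 0}, mult = (**), one = mat 1\<rparr>"

lemma det_map_matrix_int_mult:
  fixes A B :: "nat ^ 2 ^ 2"
  shows "det (map_matrix int (A ** B)) = det (map_matrix int A) * det (map_matrix int B)"
proof -
  have "map_matrix int (A ** B) = map_matrix int A ** map_matrix int B"
    by (simp add: vec_eq_iff matrix_matrix_mult_def)
  then show ?thesis
    by (simp add: det_mul)
qed

lemma monoid_M2N0: "monoid M2N0"
proof -
  have "map_matrix int (mat 1 :: nat ^ 2 ^ 2) = mat 1"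
    by (simp add: vec_eq_iff mat_def)
  then show ?thesis
    by unfold_locales
      (auto simp: M2N0_def det_map_matrix_int_mult matrix_mul_assoc simp del: One_nat_def)
qed

text \<open>The library's \<open>irreducible\<close> is phrased with proper left divisors, which is tailored to the
  commutative case; in this noncommutative monoid atoms are defined through factorizations.\<close>

definition atom :: "('a, 'b) monoid_scheme \<Rightarrow> 'a \<Rightarrow> bool" where
  "atom G a \<longleftrightarrow> a \<in> carrier G \<and> a \<notin> Units G \<and>
     (\<forall>b \<in> carrier G. \<forall>c \<in> carrier G. a = b \<otimes>\<^bsub>G\<^esub> c \<longrightarrow> b \<in> Units G \<or> c \<in> Units G)"

definition bisym :: "nat \<Rightarrow> nat \<Rightarrow> nat ^ 2 ^ 2" where
  "bisym x y = vector [vector [x, y], vector [y, x]]"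

definition B_star :: "(nat ^ 2 ^ 2) set" where
  "B_star = {bisym x y | x y. bisym x y \<in> carrier M2N0 \<and> gcd x y = 1}"

end

theory Submission
  imports Defs
begin

text \<open>
  Write a non-unit \<open>X = bisym x y\<close> as a product \<open>A ** B\<close> of non-units, with \<open>A\<close> having rows
  \<open>(a, b)\<close>, \<open>(c, d)\<close> and \<open>B\<close> having rows \<open>(e, f)\<close>, \<open>(g, h)\<close>. Then
  \<open>x = a * e + b * g = c * f + d * h\<close> and \<open>y = a * f + b * h = c * e + d * g\<close>.

  The coprimality of \<open>x\<close> and \<open>y\<close> is what excludes zero entries: a zero in \<open>A\<close> makes
  the other entry of its row divide both \<open>x\<close> and \<open>y\<close>, and this forces \<open>A\<close> to be a
  permutation matrix, hence a unit; likewise for \<open>B\<close> (\<open>zero_entry_imp_triv\<close>,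
  \<open>nonunit_factors_positive\<close>).

  Once all eight entries are positive, the inequality of arithmetic and geometric means for both
  expressions of \<open>y\<close> gives \<open>y\<^sup>4 \<ge> 16 * (a * f * b * h) * (c * e * d * g)\<close>. Regrouped, the right side
  is \<open>16 * (a * e * b * g) * (c * f * d * h)\<close>, a product over two pairs of positive integers
  each with sum \<open>x\<close>. Two positive integers with sum \<open>x\<close> have product at least \<open>x - 1\<close>, so
  \<open>y\<^sup>4 \<ge> 16 * (x - 1)\<^sup>2\<close>, which is the bound on \<open>x\<close> (\<open>four_products_bound\<close>). The bound on \<open>y\<close>
  arises by exchanging the columns of \<open>B\<close>. Equality requires all the products making up \<open>y\<close> to
  agree and one summand of each expression for \<open>x\<close> to be \<open>1\<close>, which is met by the square of \<open>bisym 1 2\<close>.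
\<close>

section \<open>Arithmetic of the entries\<close>

lemma four_mult_le_power2_add:
  fixes p q :: int
  shows "4 * (p * q) \<le> (p + q)\<^sup>2"
  using zero_le_power2[of "p - q"] by (simp add: power2_eq_square algebra_simps)

lemma pred_add_le_mult:
  fixes p q :: int
  assumes "1 \<le> p" "1 \<le> q"
  shows "p + q - 1 \<le> p * q"
  using mult_nonneg_nonneg[of "p - 1" "q - 1"] assms by (simp add: algebra_simps)

text \<open>Each summand of \<open>y\<close> mixes one factor from an expression of \<open>x\<close> with one from the other. The
  product of all four summands can be regrouped by the expressions of \<open>x\<close>, and so the estimate
  passes through fourth powers.\<close>

lemma four_products_bound:
  fixes a b c d e f g h x y :: int
  assumes pos: "1 \<le> a" "1 \<le> b" "1 \<le> c" "1 \<le> d" "1 \<le> e" "1 \<le> f" "1 \<le> g" "1 \<le> h"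
    and x: "a * e + b * g = x" "c * f + d * h = x"
    and y: "a * f + b * h = y" "c * e + d * g = y"
  shows "4 * (x - 1) \<le> y\<^sup>2"
proof (rule power2_le_imp_le)
  have one_le: "1 \<le> p * q" if "1 \<le> p" "1 \<le> q" for p q :: int
    using mult_mono[of 1 p 1 q] that by simp
  have prods: "1 \<le> a * e" "1 \<le> b * g" "1 \<le> c * f" "1 \<le> d * h"
    using pos by (simp_all add: one_le)
  have "x - 1 \<le> (a * e) * (b * g)" "x - 1 \<le> (c * f) * (d * h)"
    using pred_add_le_mult[OF prods(1,2)] pred_add_le_mult[OF prods(3,4)] x by simp_all
  moreover have "0 \<le> x - 1"
    using prods x by linarith
  ultimately have "(x - 1) * (x - 1) \<le> ((a * e) * (b * g)) * ((c * f) * (d * h))"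
    by (intro mult_mono) auto
  then have "(4 * (x - 1))\<^sup>2 \<le> (4 * ((a * f) * (b * h))) * (4 * ((c * e) * (d * g)))"
    by (simp add: power2_eq_square algebra_simps)
  also have "\<dots> \<le> y\<^sup>2 * y\<^sup>2"
    using four_mult_le_power2_add[of "a * f" "b * h"] four_mult_le_power2_add[of "c * e" "d * g"]
      pos y by (intro mult_mono) auto
  finally show "(4 * (x - 1))\<^sup>2 \<le> (y\<^sup>2)\<^sup>2"
    by (simp add: power2_eq_square)
qed simp

text \<open>The equations say that the matrix with rows \<open>(a, 0)\<close>, \<open>(c, d)\<close> is a left factor of
  \<open>bisym x y\<close>. A zero in another position, or in the right factor, reduces to this case by
  exchanging rows or columns and transposing.\<close>

lemma zero_entry_imp_triv:
  fixes a c d e f g h x y :: nat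
  assumes "a * e = x" "a * f = y" "c * e + d * g = y" "c * f + d * h = x"
    and "gcd x y = 1" "x \<noteq> y"
  shows "a = 1 \<and> c = 0 \<and> d = 1"
proof -
  have "a dvd gcd x y"
    using assms by (intro gcd_greatest) auto
  then have a: "a = 1"
    using assms by simp
  have c: "c = 0"
  proof (rule ccontr)
    \<comment> \<open>Now \<open>(e, f) = (x, y)\<close>, so a positive \<open>c\<close> would make each of \<open>x\<close>, \<open>y\<close> bound the other.\<close>
    assume "c \<noteq> 0"
    then have "e \<le> c * e" "f \<le> c * f"
      by simp_all
    moreover have "c * e \<le> y" "c * f \<le> x" "e = x" "f = y"
      using assms(1,2) assms(3,4)[symmetric] a by simp_all
    ultimately have "x \<le> y" "y \<le> x"
      by linarith+
    then show False
      using assms by simp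
  qed
  then have "x = d * h" "y = d * g"
    using assms(3,4) by simp_all
  then have "d dvd gcd x y"
    by simp
  then show ?thesis
    using assms a c by simp
qed

section \<open>Units and factorizations in the matrix monoid\<close>

lemma carrier_M2N0_iff:
  "A \<in> carrier M2N0 \<longleftrightarrow> A $ 1 $ 1 * A $ 2 $ 2 \<noteq> A $ 1 $ 2 * A $ 2 $ 1"
proof -
  have "A \<in> carrier M2N0 \<longleftrightarrow> int (A $ 1 $ 1 * A $ 2 $ 2) \<noteq> int (A $ 1 $ 2 * A $ 2 $ 1)"
    by (simp add: M2N0_def det_2)
  then show ?thesis
    by (simp only: of_nat_eq_iff)
qed

lemma mult_M2N0_entry:
  "(A \<otimes>\<^bsub>M2N0\<^esub> B) $ i $ j = A $ i $ 1 * B $ 1 $ j + A $ i $ 2 * B $ 2 $ j"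
  by (simp add: M2N0_def matrix_matrix_mult_def sum_2)

lemma one_M2N0_entry: "\<one>\<^bsub>M2N0\<^esub> $ i $ j = (if i = j then 1 else 0)"
  by (simp add: M2N0_def mat_def)

lemma matrix_eq_2_iff:
  fixes A B :: "'a ^ 2 ^ 2"
  shows "A = B \<longleftrightarrow> A $ 1 $ 1 = B $ 1 $ 1 \<and> A $ 1 $ 2 = B $ 1 $ 2 \<and>
    A $ 2 $ 1 = B $ 2 $ 1 \<and> A $ 2 $ 2 = B $ 2 $ 2"
  by (auto simp: vec_eq_iff forall_2)

lemma bisym_entry [simp]:
  "bisym x y $ 1 $ 1 = x" "bisym x y $ 1 $ 2 = y" "bisym x y $ 2 $ 1 = y" "bisym x y $ 2 $ 2 = x"
  by (simp_all add: bisym_def)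

lemma bisym_in_B_star_iff: "bisym x y \<in> B_star \<longleftrightarrow> x \<noteq> y \<and> gcd x y = 1"
proof -
  have "x * x = y * y \<longleftrightarrow> x = y"
    by (metis power2_eq_iff_nonneg power2_eq_square zero_le)
  then show ?thesis
    unfolding B_star_def carrier_M2N0_iff by (auto simp: matrix_eq_2_iff)
qed

lemma bisym_in_carrier: "bisym x y \<in> B_star \<Longrightarrow> bisym x y \<in> carrier M2N0"
  by (auto simp: B_star_def)

text \<open>Both permutation matrices are involutions.\<close>

lemma permutation_matrix_Units:
  assumes "A = bisym 1 0 \<or> A = bisym 0 1"
  shows "A \<in> Units M2N0"
proof -
  have "A \<in> carrier M2N0" "A \<otimes>\<^bsub>M2N0\<^esub> A = \<one>\<^bsub>M2N0\<^esub>"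
    using assms by (auto simp: carrier_M2N0_iff matrix_eq_2_iff mult_M2N0_entry one_M2N0_entry)
  then show ?thesis
    unfolding Units_def by blast
qed

text \<open>If the entries of \<open>A\<close> were positive, the zeros of the identity matrix would force every
  entry of a right inverse of \<open>A\<close> to vanish.\<close>

lemma Units_M2N0_zero_entry:
  assumes "A \<in> Units M2N0"
  shows "A $ 1 $ 1 = 0 \<or> A $ 1 $ 2 = 0 \<or> A $ 2 $ 1 = 0 \<or> A $ 2 $ 2 = 0"
proof -
  obtain B where "A \<otimes>\<^bsub>M2N0\<^esub> B = \<one>\<^bsub>M2N0\<^esub>"
    using assms unfolding Units_def by blast
  then show ?thesis
    by (auto simp: matrix_eq_2_iff mult_M2N0_entry one_M2N0_entry)
qed

lemma nonunit_factors_positive: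
  assumes X: "bisym x y = A \<otimes>\<^bsub>M2N0\<^esub> B"
    and nonunit: "A \<notin> Units M2N0" "B \<notin> Units M2N0"
    and xy: "gcd x y = 1" "x \<noteq> y"
  shows "0 < A $ i $ j" "0 < B $ i $ j"
proof -
  define a b c d where A: "a = A $ 1 $ 1" "b = A $ 1 $ 2" "c = A $ 2 $ 1" "d = A $ 2 $ 2"
  define e f g h where B: "e = B $ 1 $ 1" "f = B $ 1 $ 2" "g = B $ 2 $ 1" "h = B $ 2 $ 2"
  have eqs: "a * e + b * g = x" "a * f + b * h = y" "c * e + d * g = y" "c * f + d * h = x"
    using X by (simp_all add: matrix_eq_2_iff mult_M2N0_entry A B)
  have yx: "gcd y x = 1" "y \<noteq> x"
    using xy by (simp_all add: gcd.commute)
  have "A \<noteq> bisym 1 0" "A \<noteq> bisym 0 1"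
    using nonunit(1) permutation_matrix_Units by blast+
  then have A_not: "\<not> (a = 1 \<and> b = 0 \<and> c = 0 \<and> d = 1)" "\<not> (a = 0 \<and> b = 1 \<and> c = 1 \<and> d = 0)"
    by (simp_all add: matrix_eq_2_iff A)
  have "B \<noteq> bisym 1 0" "B \<noteq> bisym 0 1"
    using nonunit(2) permutation_matrix_Units by blast+
  then have B_not: "\<not> (e = 1 \<and> f = 0 \<and> g = 0 \<and> h = 1)" "\<not> (e = 0 \<and> f = 1 \<and> g = 1 \<and> h = 0)"
    by (simp_all add: matrix_eq_2_iff B)
  have "b \<noteq> 0"
    by (rule notI)
      (use zero_entry_imp_triv[of a e x f y c d g h] eqs xy A_not in simp)
  moreover have "a \<noteq> 0"
    by (rule notI)
      (use zero_entry_imp_triv[of b g x h y d c e f] eqs xy A_not in \<open>simp add: add.commute\<close>)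
  moreover have "d \<noteq> 0"
    by (rule notI)
      (use zero_entry_imp_triv[of c e y f x a b g h] eqs yx A_not in simp)
  moreover have "c \<noteq> 0"
    by (rule notI)
      (use zero_entry_imp_triv[of d g y h x b a e f] eqs yx A_not in \<open>simp add: add.commute\<close>)
  moreover have "g \<noteq> 0"
    by (rule notI)
      (use zero_entry_imp_triv[of e a x c y f h b d] eqs xy B_not in \<open>simp add: mult.commute\<close>)
  moreover have "e \<noteq> 0"
    by (rule notI)
      (use zero_entry_imp_triv[of g b x d y h f a c] eqs xy B_not in \<open>simp add: mult.commute add.commute\<close>)
  moreover have "h \<noteq> 0"
    by (rule notI)
      (use zero_entry_imp_triv[of f a y c x e g b d] eqs yx B_not in \<open>simp add: mult.commute\<close>)
  moreover have "f \<noteq> 0"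
    by (rule notI)
      (use zero_entry_imp_triv[of h b y d x g e a c] eqs yx B_not in \<open>simp add: mult.commute add.commute\<close>)
  ultimately show "0 < A $ i $ j" "0 < B $ i $ j"
    using exhaust_2[of i] exhaust_2[of j] by (auto simp: A B)
qed

section \<open>The bounds and their sharpness\<close>

lemma non_atom_bisym_bounds:
  assumes X: "bisym x y \<in> B_star" and non_atom: "\<not> atom M2N0 (bisym x y)"
  shows "4 * (int x - 1) \<le> (int y)\<^sup>2 \<and> 4 * (int y - 1) \<le> (int x)\<^sup>2"
proof (cases "bisym x y \<in> Units M2N0")
  case True
  then have "x = 0 \<or> y = 0"
    using Units_M2N0_zero_entry by fastforce
  then show ?thesis
    using X by (auto simp: bisym_in_B_star_iff)
next
  case False
  have xy: "gcd x y = 1" "x \<noteq> y"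
    using X by (simp_all add: bisym_in_B_star_iff)
  obtain A B where AB: "bisym x y = A \<otimes>\<^bsub>M2N0\<^esub> B" "A \<notin> Units M2N0" "B \<notin> Units M2N0"
    using non_atom False bisym_in_carrier[OF X] by (auto simp: atom_def)
  have pos: "1 \<le> int (A $ i $ j)" "1 \<le> int (B $ i $ j)" for i j
    using nonunit_factors_positive[OF AB xy, of i j] by linarith+
  have "int (bisym x y $ i $ j) =
      int (A $ i $ 1) * int (B $ 1 $ j) + int (A $ i $ 2) * int (B $ 2 $ j)" for i j
    by (simp add: AB(1) mult_M2N0_entry)
  from this[of 1 1] this[of 1 2] this[of 2 1] this[of 2 2]
  have eqs: "int (A $ 1 $ 1) * int (B $ 1 $ 1) + int (A $ 1 $ 2) * int (B $ 2 $ 1) = int x"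
    "int (A $ 1 $ 1) * int (B $ 1 $ 2) + int (A $ 1 $ 2) * int (B $ 2 $ 2) = int y"
    "int (A $ 2 $ 1) * int (B $ 1 $ 1) + int (A $ 2 $ 2) * int (B $ 2 $ 1) = int y"
    "int (A $ 2 $ 1) * int (B $ 1 $ 2) + int (A $ 2 $ 2) * int (B $ 2 $ 2) = int x"
    by simp_all
  show ?thesis
  proof
    show "4 * (int x - 1) \<le> (int y)\<^sup>2"
      by (rule four_products_bound[OF pos(1) pos(1) pos(1) pos(1) pos(2) pos(2) pos(2) pos(2)
            eqs(1,4,2,3)])
    \<comment> \<open>The columns of \<open>B\<close> are exchanged.\<close>
    show "4 * (int y - 1) \<le> (int x)\<^sup>2"
      by (rule four_products_bound[OF pos(1) pos(1) pos(1) pos(1) pos(2) pos(2) pos(2) pos(2)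
            eqs(2,3,1,4)])
  qed
qed

lemma rat_bound_of_int_bound:
  fixes m n :: nat
  assumes "4 * (int m - 1) \<le> (int n)\<^sup>2"
  shows "(of_nat m :: rat) \<le> 1 + (of_nat n)\<^sup>2 / 4"
proof -
  have "(of_int (4 * (int m - 1)) :: rat) \<le> of_int ((int n)\<^sup>2)"
    using assms by (simp only: of_int_le_iff)
  then show ?thesis
    by (simp add: field_simps)
qed

lemma positive_product_not_atom:
  assumes "A \<in> carrier M2N0" "B \<in> carrier M2N0" "\<forall>i j. 0 < A $ i $ j" "\<forall>i j. 0 < B $ i $ j"
  shows "\<not> atom M2N0 (A \<otimes>\<^bsub>M2N0\<^esub> B)"
  using assms Units_M2N0_zero_entry unfolding atom_def by (metis less_numeral_extra(3))

lemma bisym_5_4_not_atom: "\<not> atom M2N0 (bisym 5 4)"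
proof -
  have "bisym 5 4 = bisym 1 2 \<otimes>\<^bsub>M2N0\<^esub> bisym 1 2"
    by (simp add: matrix_eq_2_iff mult_M2N0_entry)
  then show ?thesis
    using positive_product_not_atom[of "bisym 1 2" "bisym 1 2"]
    by (simp add: carrier_M2N0_iff forall_2)
qed

lemma bisym_4_5_not_atom: "\<not> atom M2N0 (bisym 4 5)"
proof -
  have "bisym 4 5 = bisym 1 2 \<otimes>\<^bsub>M2N0\<^esub> bisym 2 1"
    by (simp add: matrix_eq_2_iff mult_M2N0_entry)
  then show ?thesis
    using positive_product_not_atom[of "bisym 1 2" "bisym 2 1"]
    by (simp add: carrier_M2N0_iff forall_2)
qed

theorem theorem6p3:
  shows "(\<forall>x y :: nat. bisym x y \<in> B_star \<and> \<not> atom M2N0 (bisym x y) \<longrightarrow>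
            (of_nat x :: rat) \<le> 1 + (of_nat y)\<^sup>2 / 4 \<and>
            (of_nat y :: rat) \<le> 1 + (of_nat x)\<^sup>2 / 4)
       \<and> (\<exists>x y :: nat. bisym x y \<in> B_star \<and> \<not> atom M2N0 (bisym x y) \<and>
            (of_nat x :: rat) = 1 + (of_nat y)\<^sup>2 / 4)
       \<and> (\<exists>x y :: nat. bisym x y \<in> B_star \<and> \<not> atom M2N0 (bisym x y) \<and>
            (of_nat y :: rat) = 1 + (of_nat x)\<^sup>2 / 4)"
proof (intro conjI)
  show "\<forall>x y :: nat. bisym x y \<in> B_star \<and> \<not> atom M2N0 (bisym x y) \<longrightarrow>
            (of_nat x :: rat) \<le> 1 + (of_nat y)\<^sup>2 / 4 \<and>
            (of_nat y :: rat) \<le> 1 + (of_nat x)\<^sup>2 / 4"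
    using non_atom_bisym_bounds rat_bound_of_int_bound by blast
  have coprime: "gcd 5 4 = (1 :: nat)" "gcd 4 5 = (1 :: nat)"
    by (simp_all add: gcd_non_0_nat)
  show "\<exists>x y :: nat. bisym x y \<in> B_star \<and> \<not> atom M2N0 (bisym x y) \<and>
            (of_nat x :: rat) = 1 + (of_nat y)\<^sup>2 / 4"
    by (rule exI[of _ 5], rule exI[of _ 4])
      (use bisym_5_4_not_atom coprime in \<open>simp add: bisym_in_B_star_iff\<close>)
  show "\<exists>x y :: nat. bisym x y \<in> B_star \<and> \<not> atom M2N0 (bisym x y) \<and>
            (of_nat y :: rat) = 1 + (of_nat x)\<^sup>2 / 4"
    by (rule exI[of _ 4], rule exI[of _ 5])
      (use bisym_4_5_not_atom coprime in \<open>simp add: bisym_in_B_star_iff\<close>)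
qed

end
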